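(* Let $a,b,c$ be nonzero real numbers, let $\{u_n\}$ be the generalized bi-periodic Fibonacci sequence, and let $U=\begin{pmatrix} ab & cb\\ a & 0\end{pmatrix}$. Then for every nonnegative integer $n$, $$U^{n}=(ab)^{\lfloor n/2\rfloor}\begin{pmatrix} b^{\zeta(n)}u_{n+1} & c\,b\,a^{-\zeta(n+1)}u_{n}\\ a^{\zeta(n)}u_{n} & c\,b^{\zeta(n)}u_{n-1}\end{pmatrix}.$$
   Context: For nonzero real numbers $a,b,c$, the generalized bi-periodic Fibonacci sequence $\{u_n\}$ is defined by $u_0=0$, $u_1=1$ and $u_n=\chi(n)u_{n-1}+c\,u_{n-2}$ for $n\ge 2$, where $\chi(n)=a$ if $n$ is even and $\chi(n)=b$ if $n$ is odd. It is extended to negative indices by the same recurrence run backwards (so $u_{-1}=1/c$). The parity function is $\zeta(n)=0$ if $n$ is even and $\zeta(n)=1$ if $n$ is odd. *)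

theory Defs
  imports Complex_Main "Jordan_Normal_Form.Matrix"
begin

definition chi :: "real \<Rightarrow> real \<Rightarrow> int \<Rightarrow> real" where
  "chi a b n = (if even n then a else b)"

definition zeta :: "int \<Rightarrow> int" where
  "zeta n = (if even n then 0 else 1)"

function biperiodic_fib :: "real \<Rightarrow> real \<Rightarrow> real \<Rightarrow> int \<Rightarrow> real" where
  "biperiodic_fib a b c n =
     (if n = 0 then 0
      else if n = 1 then 1
      else if n \<ge> 2 then
        chi a b n * biperiodic_fib a b c (n - 1) + c * biperiodic_fib a b c (n - 2)
      else
        (biperiodic_fib a b c (n + 2) - chi a b (n + 2) * biperiodic_fib a b c (n + 1)) / c)"
  by pat_completeness auto
termination
  by (relation "measure (\<lambda>(a, b, c, n). nat (if n \<ge> 0 then n else 1 - n))") auto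

declare biperiodic_fib.simps [simp del]

lemma biperiodic_fib_0: "biperiodic_fib a b c 0 = 0"
  and biperiodic_fib_1: "biperiodic_fib a b c 1 = 1"
  by (simp_all add: biperiodic_fib.simps)

lemma biperiodic_fib_rec:
  assumes "c \<noteq> 0"
  shows "biperiodic_fib a b c n =
           chi a b n * biperiodic_fib a b c (n - 1) + c * biperiodic_fib a b c (n - 2)"
proof (cases "n \<ge> 2")
  case True
  then show ?thesis by (subst biperiodic_fib.simps) simp
next
  case False
  then have "biperiodic_fib a b c (n - 2) =
      (biperiodic_fib a b c n - chi a b n * biperiodic_fib a b c (n - 1)) / c"
    by (subst biperiodic_fib.simps) simp
  with assms show ?thesis by simp
qed

lemma biperiodic_fib_minus_1: "c \<noteq> 0 \<Longrightarrow> biperiodic_fib a b c (- 1) = 1 / c"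
  using biperiodic_fib_rec[of c a b 1]
  by (simp add: biperiodic_fib_0 biperiodic_fib_1 field_simps)

end

theory Submission
  imports Defs
begin

text \<open>Induct on n via U^(n+1) = U^n * U. The second column of the product is cb times the
  first column of U^n. In the first column each entry is a sum that the recurrence, at n+2 in the
  upper row and at n+1 in the lower, collapses to a single u-term. Which of a, b multiplies in the
  recurrence depends on parity; the powers with exponent zeta and the factor (ab)^(n div 2) absorb
  exactly this.\<close>

text \<open>Keeps products in literal 2x2 form, so that the induction step reduces to comparing four
  scalar entries.\<close>

lemma mult_mat_of_rows_list_2:
  "mat_of_rows_list 2 [[p, q], [r, s]] * mat_of_rows_list 2 [[p', q'], [r', s']] =
    mat_of_rows_list 2
      [[p * p' + q * r', p * q' + q * s'], [r * p' + s * r', r * q' + s * s']]"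
  for p :: "'a :: semiring_0"
  by (rule eq_matI)
    (auto simp: mat_of_rows_list_def scalar_prod_def numeral_2_eq_2 less_Suc_eq)

lemma smult_mat_of_rows_list_2:
  "k \<cdot>\<^sub>m mat_of_rows_list 2 [[p, q], [r, s]] =
    mat_of_rows_list 2 [[k * p, k * q], [k * r, k * s]]"
  by (rule eq_matI) (auto simp: mat_of_rows_list_def numeral_2_eq_2 less_Suc_eq)

lemma one_mat_2: "1\<^sub>m 2 = mat_of_rows_list 2 [[1, 0], [0, 1]]"
  by (rule eq_matI) (auto simp: mat_of_rows_list_def numeral_2_eq_2 less_Suc_eq)

theorem mainTheorem1:
  fixes a b c :: real and n :: nat
  assumes "a \<noteq> 0" and "b \<noteq> 0" and "c \<noteq> 0"
  defines "u \<equiv> biperiodic_fib a b c"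
    and "U \<equiv> mat_of_rows_list 2 [[a * b, c * b], [a, 0]]"
  shows "U ^\<^sub>m n =
    (a * b) ^ (n div 2) \<cdot>\<^sub>m
      mat_of_rows_list 2
        [[b powi zeta (int n) * u (int n + 1), c * b * a powi (- zeta (int n + 1)) * u (int n)],
         [a powi zeta (int n) * u (int n),     c * b powi zeta (int n) * u (int n - 1)]]"
proof (induction n)
  case 0
  have "U ^\<^sub>m 0 = 1\<^sub>m 2"
    by (simp add: U_def mat_of_rows_list_def numeral_2_eq_2)
  \<comment> \<open>The lower right entry is c * u(-1) = 1, by the backward value u(-1) =
    1/c.\<close>
  then show ?case
    using assms(3)
    by (simp add: u_def one_mat_2 smult_mat_of_rows_list_2 zeta_def biperiodic_fib_0
        biperiodic_fib_1 biperiodic_fib_minus_1)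
next
  case (Suc n)
  \<comment> \<open>\<open>chi\<close> sees only parity, so its argument n+2 may be replaced by
    n.\<close>
  have rec2: "u (int n + 2) = chi a b (int n) * u (int n + 1) + c * u (int n)"
    using biperiodic_fib_rec[OF assms(3), of a b "int n + 2"] by (simp add: u_def chi_def add.commute)
  have rec1: "u (int n + 1) = chi a b (int n + 1) * u (int n) + c * u (int n - 1)"
    using biperiodic_fib_rec[OF assms(3), of a b "int n + 1"] by (simp add: u_def)
  have int_Suc: "int (Suc n) = int n + 1" "int n + 1 + 1 = int n + 2" "int n + 1 - 1 = int n"
    by simp_all
  show ?case
  proof (cases "even n")
    case True
    \<comment> \<open>No new factor ab: the upper left entry is ab u(n+1) + cb u(n) = b u(n+2), the
      lower left a (b u(n) + c u(n-1)) = a u(n+1).\<close>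
    then have half: "Suc n div 2 = n div 2"
      by simp
    show ?thesis
      unfolding pow_mat.simps Suc.IH int_Suc half
      using True assms(1,2) rec1 rec2
      by (simp add: U_def smult_mat_of_rows_list_2 mult_mat_of_rows_list_2 zeta_def chi_def
          power_int_minus field_simps)
  next
    case False
    \<comment> \<open>Now both first-column entries carry a factor ab, for instance ab (b u(n+1) + c
      u(n)) = ab u(n+2), which raises the outer power by one.\<close>
    then have half: "Suc n div 2 = Suc (n div 2)"
      by simp
    show ?thesis
      unfolding pow_mat.simps Suc.IH int_Suc half
      using False assms(1,2) rec1 rec2
      by (simp add: U_def smult_mat_of_rows_list_2 mult_mat_of_rows_list_2 zeta_def chi_def
          power_int_minus field_simps)
        \<comment> \<open>The upper right entry has the factor 1/a, as zeta(n+2) = 1; with u(n+1)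
          expanded to a sum, the fraction must be split for \<open>a\<close> to cancel.\<close>
        (simp add: add_divide_distrib)
  qed
qed

end
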